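(* Consider a supply chain network $G(\mathcal{A},\mathcal{V})$ where each processor $e\in\mathcal{A}$ has parameters $L^e,V^e,\mu^e>0$ and initial conditions $q^e(0)=q^e_0\ge 0$, $\rho^e(0,x)=\rho^e_0(x)$, evolving on $[0,T]$ under the network dynamics and with flow allocation rates $A^{v,e}(t)$ as described in the context. Then the cumulative arrival profiles $Q^e$ and cumulative exit profiles $W^e$ satisfy the following system: $$\frac{d}{dt}Q^e(t)=A^{v,e}(t)\sum_{\bar e\in\mathcal{I}^v}\frac{d}{dt}W^{\bar e}(t)\quad\text{for almost every }t,\qquad \forall v\in\mathcal{V},\ e\in\mathcal{O}^v,$$ $$\hat Q^e(t)=\begin{cases}0, & t\le 0,\\ q_0^e+Q^e(t), & 0<t\le T,\end{cases}\qquad\forall e\in\mathcal{A},$$ and, for all $e\in\mathcal{A}$, $$W^e(t)=\begin{cases}\displaystyle\int_{L^e-tV^e}^{L^e}\rho^e_0(\zeta)\,d\zeta, & t<\frac{L^e}{V^e},\\[2mm] \displaystyle\inf_{\tau\le t-\frac{L^e}{V^e}}\{\hat Q^e(\tau)-\mu^e\tau\}+\Big(t-\frac{L^e}{V^e}\Big)\mu^e+\int_0^{L^e}\rho_0^e(\zeta)\,d\zeta, & t\ge\frac{L^e}{V^e}.\end{cases}$$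
   Context: $G(\mathcal{A},\mathcal{V})$ is a finite directed graph; each arc $e\in\mathcal{A}$ is a processor, identified with the spatial interval $[0,L^e]$, with constant processing speed $V^e$ and flow capacity $\mu^e$, and with a buffer queue at its upstream end. For $v\in\mathcal{V}$, $\mathcal{I}^v$ and $\mathcal{O}^v$ are the sets of incoming and outgoing arcs. Arcs that are not outgoing from any $v\in\mathcal{V}$ receive a prescribed external inflow. Allocation rates: $0\le A^{v,e}(t)\le 1$ and $\sum_{e\in\mathcal{O}^v}A^{v,e}(t)=1$ if $|\mathcal{O}^v|>1$, and $A^{v,e}(t)\equiv1$ if $|\mathcal{O}^v|=1$; $A^{v,e}(t)$ is the proportion of the total flow leaving the arcs of $\mathcal{I}^v$ at time $t$ that is sent to the queue of $e\in\mathcal{O}^v$. For each $e$, $Q^e(t)$ is the cumulative number of products that have arrived at the queue of $e$ during $[0,t]$ (non-decreasing, left-continuous, $Q^e(0)=0$), and $\hat Q^e$, defined in the claim, incorporates the initial queue. The cumulative number of products released from the queue into processor $e$ by time $t$ is $\overline U^e(t)=\inf_{\tau\le t}\{\hat Q^e(\tau)+\mu^e(t-\tau)\}$. The density $\rho^e$ on the processor solves $\partial_t\rho^e+V^e\partial_x\rho^e=0$ with $\rho^e(0,x)=\rho^e_0(x)$, where $\rho^e_0\in L^1([0,L^e])$ and $0\le\rho_0^e\le\mu^e/V^e$, and with boundary inflow $V^e\rho^e(t,0)=\frac{d}{dt}\overline U^e(t)$ for a.e. $t$; that is, $\rho^e(t,x)=\rho^e_0(x-V^et)$ for $x>V^et$,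 and $V^e\rho^e(t,x)=(\overline U^e)'(t-x/V^e)$ for $x<V^et$. The cumulative number of products that have left processor $e$ by time $t$ is $W^e(t)=\int_0^tV^e\rho^e(s,L^e)\,ds$. *)

theory Defs
  imports "HOL-Analysis.Analysis" "Graph_Theory.Digraph"
begin

definition Q_hat :: "real \<Rightarrow> (real \<Rightarrow> real) \<Rightarrow> real \<Rightarrow> real" where
  "Q_hat q0 Q t = (if t \<le> 0 then 0 else q0 + Q t)"

text \<open>The infimum ranges over all real \<open>\<tau> \<le> t\<close>, negative ones included. It is bounded below as
  soon as \<open>q0\<close>, \<open>\<mu>\<close> and \<open>Q\<close> (on the positive times up to \<open>t\<close>) are nonnegative.\<close>

definition released :: "real \<Rightarrow> (real \<Rightarrow> real) \<Rightarrow> real \<Rightarrow> real" where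
  "released \<mu> Qh t = (INF \<tau>\<in>{..t}. Qh \<tau> + \<mu> * (t - \<tau>))"

definition exit_profile :: "real \<Rightarrow> real \<Rightarrow> (real \<Rightarrow> real \<Rightarrow> real) \<Rightarrow> real \<Rightarrow> real" where
  "exit_profile V L \<rho> t = (LINT s:{0..t}|lebesgue. V * \<rho> s L)"

text \<open>The solution on \<open>[0,T] \<times> [0,L]\<close> of \<open>\<rho>\<^sub>t + V \<rho>\<^sub>x = 0\<close> with initial datum \<open>\<rho>0\<close> and boundary
  inflow \<open>V \<rho>(t,0) = U'(t)\<close>, written along characteristics. In the second clause \<open>s\<close> is the time at
  which the characteristic through \<open>(s + x/V, x)\<close> enters the processor, so that the clause says
  \<open>V \<rho>(t,x) = U'(t - x/V)\<close> for \<open>x < V t\<close>; the values of \<open>\<rho>\<close> on a null set of these characteristics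
  are unconstrained. Taking \<open>x = 0\<close> gives the boundary condition.\<close>

definition transport_solution ::
    "real \<Rightarrow> real \<Rightarrow> real \<Rightarrow> (real \<Rightarrow> real) \<Rightarrow> (real \<Rightarrow> real) \<Rightarrow> (real \<Rightarrow> real \<Rightarrow> real) \<Rightarrow> bool" where
  "transport_solution T L V \<rho>0 U \<rho> \<longleftrightarrow>
     (\<forall>t\<in>{0..T}. \<forall>x\<in>{0..L}. x > V * t \<longrightarrow> \<rho> t x = \<rho>0 (x - V * t)) \<and>
     (AE s\<in>{0<..<T} in lebesgue. \<forall>x\<in>{0..L}. s + x / V \<le> T \<longrightarrow>
        (U has_real_derivative V * \<rho> (s + x / V) x) (at s))"

text \<open>Only \<open>verts G\<close> carries junction conditions. An arc whose \<open>tail\<close> is not in \<open>verts G\<close> is an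
  entry arc: its profile \<open>Q e\<close> is the prescribed external inflow and is subject only to
  \<open>Q_mono\<close>, \<open>Q_left_continuous\<close> and \<open>Q_zero\<close>. Likewise an arc whose \<open>head\<close> is not in \<open>verts G\<close>
  leaves the network. For this reason \<open>wf_digraph\<close> is not assumed.\<close>

locale supply_chain_network =
  fixes G :: "('v, 'e) pre_digraph"
    and T :: real
    and L V \<mu> q0 :: "'e \<Rightarrow> real"
    and \<rho>0 :: "'e \<Rightarrow> real \<Rightarrow> real"
    and A :: "'v \<Rightarrow> 'e \<Rightarrow> real \<Rightarrow> real"
    and Q :: "'e \<Rightarrow> real \<Rightarrow> real"
    and \<rho> :: "'e \<Rightarrow> real \<Rightarrow> real \<Rightarrow> real"
  assumes finite_graph: "finite (verts G)" "finite (arcs G)"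
    and T_pos: "T > 0"
    and parameters_pos: "e \<in> arcs G \<Longrightarrow> L e > 0 \<and> V e > 0 \<and> \<mu> e > 0"
    and q0_nonneg: "e \<in> arcs G \<Longrightarrow> q0 e \<ge> 0"
    and \<rho>0_L1: "e \<in> arcs G \<Longrightarrow> set_integrable lebesgue {0..L e} (\<rho>0 e)"
    and \<rho>0_bounds:
      "e \<in> arcs G \<Longrightarrow> AE x\<in>{0..L e} in lebesgue. 0 \<le> \<rho>0 e x \<and> \<rho>0 e x \<le> \<mu> e / V e"
    and A_bounds:
      "\<lbrakk>v \<in> verts G; e \<in> out_arcs G v; t \<in> {0..T}\<rbrakk> \<Longrightarrow> 0 \<le> A v e t \<and> A v e t \<le> 1"
    and A_sum:
      "\<lbrakk>v \<in> verts G; card (out_arcs G v) > 1; t \<in> {0..T}\<rbrakk> \<Longrightarrow> (\<Sum>e\<in>out_arcs G v. A v e t) = 1"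
    and A_single:
      "\<lbrakk>v \<in> verts G; card (out_arcs G v) = 1; e \<in> out_arcs G v; t \<in> {0..T}\<rbrakk> \<Longrightarrow> A v e t = 1"
    and Q_mono: "e \<in> arcs G \<Longrightarrow> mono_on {0..T} (Q e)"
    and Q_left_continuous: "\<lbrakk>e \<in> arcs G; t \<in> {0<..T}\<rbrakk> \<Longrightarrow> continuous (at_left t) (Q e)"
    and Q_zero: "e \<in> arcs G \<Longrightarrow> Q e 0 = 0"
    and density:
      "e \<in> arcs G \<Longrightarrow>
        transport_solution T (L e) (V e) (\<rho>0 e) (released (\<mu> e) (Q_hat (q0 e) (Q e))) (\<rho> e)"
    \<comment> \<open>the flow that leaves arc \<open>d\<close> at time \<open>s\<close> is \<open>V d * \<rho> d s (L d)\<close>; existence of the integral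
      is part of the condition\<close>
    and junction:
      "\<lbrakk>v \<in> verts G; e \<in> out_arcs G v; t \<in> {0..T}\<rbrakk> \<Longrightarrow>
        has_bochner_integral (lebesgue_on {0..t})
          (\<lambda>s. A v e s * (\<Sum>d\<in>in_arcs G v. V d * \<rho> d s (L d))) (Q e t)"

end

theory Submission
  imports Defs
begin

text \<open>Along characteristics, the outflow \<open>V * \<rho> s L\<close> of a processor is the reflected initial density
  up to the time \<open>L / V\<close> and the derivative of the released profile \<open>U\<close> at \<open>s - L / V\<close> afterwards.
  Since the cumulative arrivals are monotone, \<open>U\<close> is Lipschitz with constant \<open>\<mu>\<close>, so it is the
  integral of its almost everywhere derivative; together with \<open>U 0 = 0\<close> this gives the formula for
  the exit profile. The differential equation at a junction is Lebesgue's differentiation theorem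
  applied to both sides of the integrated flow balance.\<close>

section \<open>Lebesgue differentiation of indefinite integrals\<close>

lemma AE_lebesgue_interval_interior:
  fixes a b :: real
  assumes "negligible N"
    and "\<And>t. \<lbrakk>a < t; t < b; t \<notin> N\<rbrakk> \<Longrightarrow> P t"
  shows "AE t\<in>{a..b} in lebesgue. P t"
proof (rule AE_I')
  have "negligible (N \<union> {a, b})"
    using assms(1) by (simp add: negligible_Un negligible_finite)
  then show "N \<union> {a, b} \<in> null_sets lebesgue"
    by (simp add: negligible_iff_null_sets)
  show "{t \<in> space lebesgue. \<not> (t \<in> {a..b} \<longrightarrow> P t)} \<subseteq> N \<union> {a, b}"
    using assms(2) by (force simp: less_le)
qed

text \<open>Off a null set, the averages of \<open>f\<close> over intervals shrinking to an endpoint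
  \<open>t\<close> converge to \<open>f t\<close>, and the difference quotients of \<open>F\<close>
  at \<open>t\<close> are such averages.\<close>

theorem integral_has_real_derivative_AE:
  fixes f F :: "real \<Rightarrow> real"
  assumes f: "f integrable_on {a..b}"
    and F: "\<And>x. x \<in> {a..b} \<Longrightarrow> F x = integral {a..x} f"
  shows "AE t\<in>{a..b} in lebesgue. (F has_real_derivative f t) (at t)"
proof -
  \<comment> \<open>Extension by zero gives a function integrable on every interval, as the
    differentiation result demands; this survives reflection.\<close>
  define g where "g = (\<lambda>x. if x \<in> {a..b} then f x else 0)"
  have "g integrable_on UNIV"
    unfolding g_def using f by (simp only: integrable_restrict_UNIV)
  then have g: "g integrable_on cbox u v" for u v
    using integrable_on_subcbox by blast
  have g': "(\<lambda>x. g (- x)) integrable_on cbox u v" for u v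
    using g[of "-v" "-u"]
      Henstock_Kurzweil_Integration.integrable_reflect_real[where f = g and a = "-v" and b = "-u"]
    by simp
  obtain N1 where N1: "negligible N1"
    "\<And>x e. \<lbrakk>x \<notin> N1; 0 < e\<rbrakk> \<Longrightarrow> \<exists>d>0. \<forall>h. 0 < h \<and> h < d \<longrightarrow>
        \<bar>integral {x..x + h} g / h - g x\<bar> < e"
    using integrable_ccontinuous_explicit[OF g] by (auto simp: divide_inverse_commute)
  \<comment> \<open>\<open>integrable_ccontinuous_explicit\<close> only averages to the right of a point; reflection gives
    the averages to the left.\<close>
  obtain N2 where N2: "negligible N2"
    "\<And>x e. \<lbrakk>x \<notin> N2; 0 < e\<rbrakk> \<Longrightarrow> \<exists>d>0. \<forall>h. 0 < h \<and> h < d \<longrightarrow>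
        \<bar>integral {x..x + h} (\<lambda>x. g (- x)) / h - g (- x)\<bar> < e"
    using integrable_ccontinuous_explicit[OF g'] by (auto simp: divide_inverse_commute)
  show ?thesis
  proof (rule AE_lebesgue_interval_interior)
    \<comment> \<open>The exceptional set of the reflected function is reflected back; a
      differentiable image of a null set is null.\<close>
    have "negligible (uminus ` N2)"
      using N2(1) by (intro negligible_differentiable_image_negligible)
        (auto simp: differentiable_on_def intro!: derivative_intros)
    then show "negligible (N1 \<union> uminus ` N2)"
      by (rule negligible_Un[OF N1(1)])
    fix t assume t: "a < t" "t < b" "t \<notin> N1 \<union> uminus ` N2"
    then have t': "- t \<notin> N2" by force
    have gt: "g t = f t" using t by (simp add: g_def)
    have diff: "F y - F x = integral {x..y} g" if "a \<le> x" "x \<le> y" "y \<le> b" for x y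
    proof -
      have "integral {a..x} f + integral {x..y} f = integral {a..y} f"
        using that f by (intro Henstock_Kurzweil_Integration.integral_combine)
          (auto intro: integrable_on_subinterval)
      moreover have "integral {x..y} f = integral {x..y} g"
        using that by (intro integral_cong) (auto simp: g_def)
      ultimately show ?thesis using F that by auto
    qed
    show "(F has_real_derivative f t) (at t)"
      unfolding has_field_derivative_iff LIM_eq
    proof (intro allI impI)
      fix r :: real assume r: "r > 0"
      obtain d1 where d1: "d1 > 0" "\<And>h. \<lbrakk>0 < h; h < d1\<rbrakk> \<Longrightarrow> \<bar>integral {t..t + h} g / h - f t\<bar> < r"
        using N1(2)[of t r] t r gt by auto
      obtain d2 where d2: "d2 > 0"
        "\<And>h. \<lbrakk>0 < h; h < d2\<rbrakk> \<Longrightarrow> \<bar>integral {- t..- t + h} (\<lambda>x. g (- x)) / h - f t\<bar> < r"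
        using N2(2)[of "- t" r] t' r gt by auto
      \<comment> \<open>The last two entries keep \<open>x\<close> inside \<open>{a..b}\<close>,
        where \<open>F\<close> is the integral of \<open>f\<close>.\<close>
      define s where "s = Min {d1, d2, t - a, b - t}"
      have s: "s > 0" "s \<le> d1" "s \<le> d2" "s \<le> t - a" "s \<le> b - t"
        using t d1(1) d2(1) by (auto simp: s_def)
      show "\<exists>s>0. \<forall>x. x \<noteq> t \<and> norm (x - t) < s \<longrightarrow> norm ((F x - F t) / (x - t) - f t) < r"
      proof (intro exI[of _ s] conjI allI impI s(1))
        fix x assume x: "x \<noteq> t \<and> norm (x - t) < s"
        show "norm ((F x - F t) / (x - t) - f t) < r"
        proof (cases "x > t")
          case True
          then show ?thesis
            using d1(2)[of "x - t"] diff[of t x] x s t by auto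
        next
          case False
          \<comment> \<open>Left of \<open>t\<close>, the interval \<open>{x..t}\<close> reflects to
            one that starts at \<open>- t\<close> and has length \<open>t - x\<close>, so
            \<open>d2\<close> applies.\<close>
          have "integral {- t..- x} (\<lambda>x. g (- x)) = F t - F x"
            using diff[of x t] False x s t by auto
          moreover have "(F x - F t) / (x - t) = (F t - F x) / (t - x)"
            by (metis minus_diff_eq minus_divide_divide)
          ultimately show ?thesis
            using d2(2)[of "t - x"] False x s by auto
        qed
      qed
    qed
  qed
qed

section \<open>Fundamental theorem of calculus for Lipschitz functions; affine substitution\<close>

lemma difference_quotient_LIMSEQ:
  fixes F :: "real \<Rightarrow> real"
  assumes "(F has_real_derivative D) (at x)"
  shows "(\<lambda>k. (F (x + 1 / Suc k) - F x) * Suc k) \<longlonglongrightarrow> D"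
proof -
  have "((\<lambda>h. (F (x + h) - F x) / h) \<longlongrightarrow> D) (at 0)"
    using assms by (simp add: DERIV_def)
  moreover have "filterlim (\<lambda>k. 1 / real (Suc k)) (at 0) sequentially"
    by (auto simp: filterlim_at LIMSEQ_Suc[OF lim_1_over_n] simp del: of_nat_Suc)
  ultimately have "(\<lambda>k. (F (x + 1 / Suc k) - F x) / (1 / Suc k)) \<longlonglongrightarrow> D"
    by (rule filterlim_compose)
  then show ?thesis by (simp add: field_simps)
qed

text \<open>The difference quotients of \<open>U\<close> are bounded by the Lipschitz constant, and their integrals are
  differences of averages of \<open>U\<close> near the endpoints, so dominated convergence applies.\<close>

theorem fundamental_theorem_of_calculus_lipschitz:
  fixes U f :: "real \<Rightarrow> real"
  assumes lip: "C-lipschitz_on {a..b} U" and ab: "a \<le> b"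
    and der: "AE s\<in>{a<..<b} in lebesgue. (U has_real_derivative f s) (at s)"
  shows "(f has_integral U b - U a) {a..b}" "f absolutely_integrable_on {a..b}"
proof -
  \<comment> \<open>Clamping the argument to \<open>{a..b}\<close> extends \<open>U\<close> to a
    globally Lipschitz function, so that quotients reaching past \<open>b\<close> are
    controlled.\<close>
  define u where "u x = U (max a (min b x))" for x
  have u_lip: "\<bar>u x - u y\<bar> \<le> C * \<bar>x - y\<bar>" for x y
  proof -
    have "\<bar>u x - u y\<bar> \<le> C * \<bar>max a (min b x) - max a (min b y)\<bar>"
      using lipschitz_onD[OF lip, of "max a (min b x)" "max a (min b y)"] ab
      by (auto simp: u_def dist_real_def)
    also have "\<dots> \<le> C * \<bar>x - y\<bar>"
      using lipschitz_on_nonneg[OF lip] by (intro mult_left_mono) auto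
    finally show ?thesis .
  qed
  have C: "C \<ge> 0" by (rule lipschitz_on_nonneg[OF lip])
  have "C-lipschitz_on UNIV u"
    using u_lip C by (auto intro!: lipschitz_onI simp: dist_real_def)
  then have u_cont: "continuous_on S u" for S
    using lipschitz_on_continuous_on continuous_on_subset by blast
  obtain N where N: "N \<in> null_sets lebesgue"
    "\<And>s. \<lbrakk>a < s; s < b; s \<notin> N\<rbrakk> \<Longrightarrow> (U has_real_derivative f s) (at s)"
  proof -
    obtain N where N: "N \<in> null_sets lebesgue"
      "{s \<in> space lebesgue. \<not> (s \<in> {a<..<b} \<longrightarrow> (U has_real_derivative f s) (at s))} \<subseteq> N"
      using der unfolding eventually_ae_filter by auto
    show thesis by (rule that[OF N(1)]) (use N(2) in auto)
  qed
  \<comment> \<open>The clamped function may have a kink at an endpoint, so both endpoints join the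
    exceptional set.\<close>
  define M where "M = N \<union> {a, b}"
  have M: "negligible M"
    using N(1) by (auto simp: M_def negligible_iff_null_sets[symmetric] intro!: negligible_Un negligible_finite)
  have u_der: "(u has_real_derivative f s) (at s)" if "s \<in> {a..b} - M" for s
  proof (rule has_field_derivative_transform_within_open)
    show "(U has_real_derivative f s) (at s)" "s \<in> {a<..<b}"
      using that N(2)[of s] by (auto simp: M_def less_le)
  qed (auto simp: u_def)
  \<comment> \<open>Zero on \<open>M\<close>, because dominated convergence is applied with
    convergence at every point of the interval.\<close>
  define g where "g s = (if s \<in> M then 0 else f s)" for s
  define q where "q k s = (u (s + 1 / Suc k) - u s) * Suc k" for k s
  \<comment> \<open>Starting at \<open>a - 1\<close> leaves room for a two-sided derivative at
    \<open>a\<close>.\<close>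
  define F where "F x = integral {a - 1..x} u" for x
  have F_der: "(F has_real_derivative u x) (at x)" if "x > a - 1" for x
  proof -
    have "(F has_real_derivative u x) (at x within {a - 1..x + 1})"
      unfolding F_def using that by (intro integral_has_real_derivative u_cont) auto
    moreover have "at x within {a - 1..x + 1} = at x"
      using that by (intro at_within_interior) (auto simp: interior_atLeastAtMost_real)
    ultimately show ?thesis by simp
  qed
  have F_int: "(u has_integral F y - F x) {x..y}" if "a - 1 < x" "x \<le> y" for x y
    using that by (intro fundamental_theorem_of_calculus)
      (auto simp: has_real_derivative_iff_has_vector_derivative[symmetric]
        intro!: has_field_derivative_at_within F_der)
  have q_bound: "\<bar>q k s\<bar> \<le> C" for k s
    using mult_right_mono[OF u_lip[of "s + 1 / Suc k" s], of "Suc k"]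
    by (simp add: q_def abs_mult del: of_nat_Suc)
  have q_lim: "(\<lambda>k. q k s) \<longlonglongrightarrow> f s" if "s \<in> {a..b} - M" for s
    unfolding q_def by (rule difference_quotient_LIMSEQ[OF u_der[OF that]])
  \<comment> \<open>After the shift by \<open>1 / Suc k\<close> the common part of the two integrals
    cancels. What remains are difference quotients of \<open>F\<close> at \<open>b\<close> and
    \<open>a\<close>, with limits \<open>u b\<close> and \<open>u a\<close>.\<close>
  have q_int: "(q k has_integral (F (b + 1 / Suc k) - F b) * Suc k - (F (a + 1 / Suc k) - F a) * Suc k) {a..b}"
    for k
  proof -
    have "((\<lambda>s. u (s + 1 / Suc k)) has_integral F (b + 1 / Suc k) - F (a + 1 / Suc k)) {a..b}"
      using has_integral_affinity'[OF F_int[folded cbox_interval], of "a + 1 / Suc k" "b + 1 / Suc k" 1 "1 / Suc k"] ab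
        less_trans[of "- 1" 0 "1 / real (Suc k)"]
      by (simp del: of_nat_Suc)
    from has_integral_mult_left[OF has_integral_diff[OF this F_int[of a b]], of "Suc k"] ab
    show ?thesis by (simp add: q_def[abs_def] algebra_simps)
  qed
  have "(g has_integral u b - u a) {a..b}"
  proof (rule has_integral_dominated_convergence)
    show "((\<lambda>s. if s \<in> M then 0 else q k s) has_integral
        (F (b + 1 / Suc k) - F b) * Suc k - (F (a + 1 / Suc k) - F a) * Suc k) {a..b}" for k
      by (rule has_integral_spike[OF M _ q_int]) auto
    show "(\<lambda>k. (F (b + 1 / Suc k) - F b) * Suc k - (F (a + 1 / Suc k) - F a) * Suc k)
        \<longlonglongrightarrow> u b - u a"
      using ab by (intro tendsto_diff difference_quotient_LIMSEQ F_der) auto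
    show "(\<lambda>_. C) integrable_on {a..b}" by (rule integrable_const_ivl)
    show "\<forall>s\<in>{a..b}. norm (if s \<in> M then 0 else q k s) \<le> C" for k
      using q_bound C by auto
    show "\<forall>s\<in>{a..b}. (\<lambda>k. if s \<in> M then 0 else q k s) \<longlonglongrightarrow> g s"
      using q_lim by (auto simp: g_def)
  qed
  then have g: "(g has_integral U b - U a) {a..b}"
    using ab by (simp add: u_def)
  then show "(f has_integral U b - U a) {a..b}"
    by (rule has_integral_spike[OF M, rotated]) (auto simp: g_def)
  \<comment> \<open>The uniform bound on the quotients survives the limit and upgrades gauge
    integrability to absolute integrability, as Lebesgue integrals require.\<close>
  have "norm (g s) \<le> C" if "s \<in> {a..b}" for s
  proof (cases "s \<in> M")
    case False
    then show ?thesis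
      using tendsto_rabs[OF q_lim[of s]] q_bound that
      by (auto simp: g_def intro: LIMSEQ_le_const2)
  qed (use C in \<open>simp add: g_def\<close>)
  then have "g absolutely_integrable_on {a..b}"
    using g by (intro absolutely_integrable_integrable_bound[where g = "\<lambda>_. C"]) auto
  then show "f absolutely_integrable_on {a..b}"
    by (rule absolutely_integrable_spike[OF _ M]) (auto simp: g_def)
qed

text \<open>The preimage form covers both signs of \<open>c\<close>: \<open>c = - V\<close> later
  turns exit times into initial positions, and \<open>c = 1\<close> shifts by the travel
  time.\<close>

lemma set_integral_lebesgue_real_affine:
  fixes f :: "real \<Rightarrow> real"
  assumes f: "set_integrable lebesgue S f" and c: "c \<noteq> 0"
  shows "set_integrable lebesgue {x. t + c * x \<in> S} (\<lambda>x. f (t + c * x))"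
    and "(LINT x:S|lebesgue. f x) = \<bar>c\<bar> * (LINT x:{x. t + c * x \<in> S}|lebesgue. f (t + c * x))"
proof -
  have eq: "indicator S (t + c * x) = (indicator {x. t + c * x \<in> S} x :: real)" for x
    by (simp add: indicator_def)
  show "set_integrable lebesgue {x. t + c * x \<in> S} (\<lambda>x. f (t + c * x))"
    using lebesgue_integrable_real_affine[OF f[unfolded set_integrable_def] c, of t]
    by (simp add: set_integrable_def eq)
  show "(LINT x:S|lebesgue. f x) = \<bar>c\<bar> * (LINT x:{x. t + c * x \<in> S}|lebesgue. f (t + c * x))"
    using lebesgue_integral_real_affine[OF c, of "\<lambda>x. indicator S x *\<^sub>R f x" t]
    by (simp add: set_lebesgue_integral_def eq)
qed

section \<open>The released profile as an infimum\<close>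

lemma bdd_below_released:
  fixes H :: "real \<Rightarrow> real"
  assumes "\<And>\<tau>. \<tau> \<le> t \<Longrightarrow> H \<tau> \<ge> 0" "\<mu> \<ge> 0"
  shows "bdd_below ((\<lambda>\<tau>. H \<tau> + \<mu> * (t - \<tau>)) ` {..t})"
  proof (rule bdd_belowI2)
  show "0 \<le> H \<tau> + \<mu> * (t - \<tau>)" if "\<tau> \<in> {..t}" for \<tau>
    using that assms by simp
qed

text \<open>Any \<open>\<tau> \<le> s\<close> also competes at time \<open>t\<close>, at extra cost
  \<open>\<mu> * (t - s)\<close>; this bounds the growth. Conversely a competitor
  \<open>\<tau>\<close> at time \<open>t\<close> is no worse at time \<open>s\<close> if
  \<open>\<tau> \<le> s\<close>, and otherwise is replaced by \<open>s\<close> itself, using that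
  \<open>H\<close> is monotone; so the profile does not decrease.\<close>

lemma released_lipschitz:
  assumes mono: "mono_on {..T} H" and nonneg: "\<And>\<tau>. \<tau> \<le> T \<Longrightarrow> H \<tau> \<ge> 0" and \<mu>: "\<mu> \<ge> 0"
  shows "\<mu>-lipschitz_on {..T} (released \<mu> H)"
proof (rule lipschitz_onI)
  have bdd: "bdd_below ((\<lambda>\<tau>. H \<tau> + \<mu> * (t - \<tau>)) ` {..t})" if "t \<le> T" for t
    using that nonneg \<mu> by (intro bdd_below_released) auto
  have le: "released \<mu> H t \<le> H \<tau> + \<mu> * (t - \<tau>)" if "\<tau> \<le> t" "t \<le> T" for \<tau> t
    unfolding released_def using that by (intro cINF_lower bdd) auto
  have main: "dist (released \<mu> H s) (released \<mu> H t) \<le> \<mu> * (t - s)" if st: "s \<le> t" "t \<le> T" for s t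
  proof -
    have "released \<mu> H t - \<mu> * (t - s) \<le> released \<mu> H s"
      unfolding released_def[of _ _ s]
      by (intro cINF_greatest) (use le[of _ t] st in \<open>auto simp: algebra_simps\<close>)
    moreover have "released \<mu> H s \<le> released \<mu> H t"
      unfolding released_def[of _ _ t]
    proof (intro cINF_greatest)
      fix \<tau> assume \<tau>: "\<tau> \<in> {..t}"
      show "released \<mu> H s \<le> H \<tau> + \<mu> * (t - \<tau>)"
      proof (cases "\<tau> \<le> s")
        case True
        have "\<mu> * (s - \<tau>) \<le> \<mu> * (t - \<tau>)"
          using st \<mu> by (intro mult_left_mono) auto
        then show ?thesis using le[OF True] st by auto
      next
        case False
        then have "H s \<le> H \<tau>" using \<tau> st by (intro mono_onD[OF mono]) auto
        moreover have "0 \<le> \<mu> * (t - \<tau>)" using \<tau> \<mu> by auto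
        ultimately show ?thesis using le[of s s] st by auto
      qed
    qed auto
    ultimately show ?thesis by (auto simp: dist_real_def)
  qed
  fix s t assume "s \<in> {..T}" "t \<in> {..T}"
  then show "dist (released \<mu> H s) (released \<mu> H t) \<le> \<mu> * dist s t"
    using main[of s t] main[of t s] by (cases "s \<le> t") (auto simp: dist_real_def abs_minus_commute)
qed (rule \<mu>)

text \<open>\<open>Q_hat\<close> still vanishes at time 0, the initial queue being added only just
  after, so the minimum is attained at \<open>\<tau> = 0\<close>.\<close>

lemma released_Q_hat_0:
  assumes "\<mu> \<ge> 0"
  shows "released \<mu> (Q_hat q0 Q) 0 = 0"
  unfolding released_def
proof (rule cInf_eq_minimum)
  show "0 \<in> (\<lambda>\<tau>. Q_hat q0 Q \<tau> + \<mu> * (0 - \<tau>)) ` {..0}"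
    by (rule image_eqI[of _ _ 0]) (auto simp: Q_hat_def)
qed (use assms in \<open>auto simp: Q_hat_def mult_le_0_iff\<close>)

lemma released_eq_INF:
  assumes "\<And>\<tau>. \<tau> \<le> t \<Longrightarrow> H \<tau> \<ge> 0" "\<mu> \<ge> 0"
  shows "released \<mu> H t = (INF \<tau>\<in>{..t}. H \<tau> - \<mu> * \<tau>) + t * \<mu>"
proof -
  \<comment> \<open>A real infimum without lower bound is unspecified, so one is supplied before the
    constant \<open>t * \<mu>\<close> is pulled out.\<close>
  have "bdd_below ((\<lambda>\<tau>. H \<tau> - \<mu> * \<tau>) ` {..t})"
  proof (rule bdd_belowI2)
    fix \<tau> assume "\<tau> \<in> {..t}"
    then show "- (\<mu> * t) \<le> H \<tau> - \<mu> * \<tau>"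
      using assms(1)[of \<tau>] mult_left_mono[of \<tau> t \<mu>] assms(2) by auto
  qed
  then have "(INF \<tau>\<in>{..t}. t * \<mu> + (H \<tau> - \<mu> * \<tau>)) = t * \<mu> + (INF \<tau>\<in>{..t}. H \<tau> - \<mu> * \<tau>)"
    by (intro Inf_add_eq) auto
  then show ?thesis
    by (simp add: released_def algebra_simps)
qed

lemma Q_hat_mono_on:
  assumes "q0 \<ge> 0" "mono_on {0..T} Q" "Q 0 = 0"
  shows "mono_on {..T} (Q_hat q0 Q)" "\<And>\<tau>. \<tau> \<le> T \<Longrightarrow> Q_hat q0 Q \<tau> \<ge> 0"
proof -
  have "Q \<tau> \<ge> 0" if "0 < \<tau>" "\<tau> \<le> T" for \<tau>
    using mono_onD[OF assms(2), of 0 \<tau>] that assms(3) by auto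
  then show "\<And>\<tau>. \<tau> \<le> T \<Longrightarrow> Q_hat q0 Q \<tau> \<ge> 0" "mono_on {..T} (Q_hat q0 Q)"
    using assms(1) by (auto simp: Q_hat_def intro!: mono_onI mono_onD[OF assms(2)])
qed

section \<open>Outflow of a single processor\<close>

lemma transport_solution_outflow:
  fixes q0 :: real and \<rho>0 Q :: "real \<Rightarrow> real"
  defines "H \<equiv> Q_hat q0 Q"
  assumes pos: "L > 0" "V > 0" "\<mu> > 0"
    and q0: "q0 \<ge> 0" and Q: "mono_on {0..T} Q" "Q 0 = 0"
    and \<rho>0: "set_integrable lebesgue {0..L} \<rho>0"
    and sol: "transport_solution T L V \<rho>0 (released \<mu> H) \<rho>"
    and t: "t \<in> {0..T}"
  shows "set_integrable lebesgue {0..t} (\<lambda>s. V * \<rho> s L)"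
    and "exit_profile V L \<rho> t =
      (if t < L / V
       then (LINT \<zeta>:{L - t * V..L}|lebesgue. \<rho>0 \<zeta>)
       else (INF \<tau>\<in>{..t - L / V}. H \<tau> - \<mu> * \<tau>) + (t - L / V) * \<mu>
            + (LINT \<zeta>:{0..L}|lebesgue. \<rho>0 \<zeta>))"
proof -
  define f where "f s = V * \<rho> s L" for s
  define U where "U = released \<mu> H"
  note H = Q_hat_mono_on[OF q0 Q, folded H_def]
  \<comment> \<open>The bound \<open>r\<close> is kept free: it is taken as \<open>t\<close> before
    the travel time \<open>L / V\<close>, and as \<open>L / V\<close> afterwards.\<close>
  have initial: "set_integrable lebesgue {0..r} f"
    "(LINT s:{0..r}|lebesgue. f s) = (LINT \<zeta>:{L - r * V..L}|lebesgue. \<rho>0 \<zeta>)"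
    if r: "0 \<le> r" "r \<le> t" "r \<le> L / V" for r
  proof -
    have rV: "r * V \<le> L" using r pos by (simp add: field_simps)
    have int: "set_integrable lebesgue {L - r * V..L} \<rho>0"
      by (rule set_integrable_subset[OF \<rho>0]) (use rV in auto)
    have set_eq: "{x. L + - V * x \<in> {L - r * V..L}} = {0..r}"
      using pos by (auto simp: zero_le_mult_iff mult.commute)
    note affine = set_integral_lebesgue_real_affine[OF int, of "- V" L, unfolded set_eq]
    have int0: "(\<lambda>s. V * \<rho>0 (L + - V * s)) absolutely_integrable_on {0..r}"
      using affine(1) pos by auto
    \<comment> \<open>The endpoint is left out: for \<open>r = L / V\<close> it lies on the
      characteristic \<open>x = V * t\<close>, where the initial datum does not prescribe the
      density.\<close>
    have f_eq: "f s = V * \<rho>0 (L + - V * s)" if "s \<in> {0..r} - {r}" for s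
    proof -
      have "V * s < V * r" using that pos by auto
      then have "L > V * s" using rV by (simp add: mult.commute)
      moreover have "s \<in> {0..T}" "L \<in> {0..L}" using that r t pos by auto
      ultimately have "\<rho> s L = \<rho>0 (L - V * s)"
        using sol unfolding transport_solution_def by blast
      then show ?thesis by (simp add: f_def)
    qed
    show "set_integrable lebesgue {0..r} f"
      by (rule absolutely_integrable_spike[OF int0, of "{r}"]) (use f_eq in auto)
    then have "(LINT s:{0..r}|lebesgue. f s) = integral {0..r} f"
      by (rule set_lebesgue_integral_eq_integral)
    also have "\<dots> = integral {0..r} (\<lambda>s. V * \<rho>0 (L + - V * s))"
      by (rule integral_spike[of "{r}"]) (use f_eq in auto)
    also have "\<dots> = (LINT s:{0..r}|lebesgue. V * \<rho>0 (L + - V * s))"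
      by (rule set_lebesgue_integral_eq_integral(2)[OF int0, symmetric])
    also have "\<dots> = (LINT \<zeta>:{L - r * V..L}|lebesgue. \<rho>0 \<zeta>)"
      using affine(2) pos by simp
    finally show "(LINT s:{0..r}|lebesgue. f s) = (LINT \<zeta>:{L - r * V..L}|lebesgue. \<rho>0 \<zeta>)" .
  qed
  \<comment> \<open>Integrability is carried along with the value, since \<open>LINT\<close> is 0 by
    convention for non-integrable functions and the exit profile is differentiated later.\<close>
  have "set_integrable lebesgue {0..t} f \<and> (LINT s:{0..t}|lebesgue. f s) =
      (if t < L / V
       then (LINT \<zeta>:{L - t * V..L}|lebesgue. \<rho>0 \<zeta>)
       else (INF \<tau>\<in>{..t - L / V}. H \<tau> - \<mu> * \<tau>) + (t - L / V) * \<mu>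
            + (LINT \<zeta>:{0..L}|lebesgue. \<rho>0 \<zeta>))"
  proof (cases "t < L / V")
    case True
    then show ?thesis using initial[of t] t by simp
  next
    case False
    define r where "r = L / V"
    have r: "0 < r" "r \<le> t" "r * V = L" using False pos by (auto simp: r_def)
    have lip: "\<mu>-lipschitz_on {0..t - r} U"
      unfolding U_def using r t
      by (intro lipschitz_on_subset[OF released_lipschitz[OF H]]) (use pos in auto)
    \<comment> \<open>The transport equation is read at \<open>x = L\<close>: what enters at time
      \<open>s\<close> leaves at time \<open>s + r\<close>.\<close>
    have "AE s\<in>{0<..<t - r} in lebesgue. (U has_real_derivative f (s + r)) (at s)"
      using sol[unfolded transport_solution_def U_def[symmetric], THEN conjunct2]
    proof (eventually_elim, intro impI)
      fix s assume *: "s \<in> {0<..<T} \<longrightarrow> (\<forall>x\<in>{0..L}. s + x / V \<le> T \<longrightarrow>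
          (U has_real_derivative V * \<rho> (s + x / V) x) (at s))" and s: "s \<in> {0<..<t - r}"
      show "(U has_real_derivative f (s + r)) (at s)"
        using *[rule_format, of L] s r(1) t pos unfolding f_def r_def by force
    qed
    note FTC = fundamental_theorem_of_calculus_lipschitz[OF lip _ this]
    \<comment> \<open>Nothing is released by time 0, so the difference from the fundamental theorem
      is just \<open>U (t - r)\<close>.\<close>
    have shifted: "(\<lambda>s. f (s + r)) absolutely_integrable_on {0..t - r}"
      "(LINT s:{0..t - r}|lebesgue. f (s + r)) = U (t - r)"
      using FTC r released_Q_hat_0[of \<mu> q0 Q] pos
      by (auto simp: set_lebesgue_integral_eq_integral(2) integral_unique U_def H_def)
    have "{x. - r + 1 * x \<in> {0..t - r}} = {r..t}" by auto
    note late = set_integral_lebesgue_real_affine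
      [OF shifted(1), of 1 "- r", unfolded this, simplified, folded shifted(2)]
    \<comment> \<open>At this \<open>r\<close> the lower limit \<open>L - r * V\<close> is 0: the
      whole initial load has left.\<close>
    note early = initial[of r]
    have early': "f absolutely_integrable_on {0..r}"
      using early r by (simp add: r_def)
    have f_int: "f absolutely_integrable_on {0..t}"
      using set_integrable_Un[OF early' late(1)] r by (simp add: ivl_disj_un)
    have "(f has_integral (LINT s:{0..r}|lebesgue. f s) + (LINT s:{r..t}|lebesgue. f s)) {0..t}"
      using r by (intro has_integral_combine[where c = r] has_integral_set_lebesgue early' late(1)) auto
    then have "(LINT s:{0..t}|lebesgue. f s) = (LINT s:{0..r}|lebesgue. f s) + (LINT s:{r..t}|lebesgue. f s)"
      using set_lebesgue_integral_eq_integral(2)[OF f_int] by (simp add: integral_unique)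
    moreover have "U (t - r) = (INF \<tau>\<in>{..t - r}. H \<tau> - \<mu> * \<tau>) + (t - r) * \<mu>"
      unfolding U_def using r t pos H(2) by (intro released_eq_INF) auto
    ultimately show ?thesis
      using False f_int early(2) late(2) shifted(2) r by (simp add: r_def)
  qed
  then show "set_integrable lebesgue {0..t} (\<lambda>s. V * \<rho> s L)"
    and "exit_profile V L \<rho> t =
      (if t < L / V
       then (LINT \<zeta>:{L - t * V..L}|lebesgue. \<rho>0 \<zeta>)
       else (INF \<tau>\<in>{..t - L / V}. H \<tau> - \<mu> * \<tau>) + (t - L / V) * \<mu>
            + (LINT \<zeta>:{0..L}|lebesgue. \<rho>0 \<zeta>))"
    unfolding exit_profile_def f_def by auto
qed

lemma exit_profile_has_derivative_AE:
  assumes int: "set_integrable lebesgue {0..T} (\<lambda>s. V * \<rho> s L)"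
  shows "AE t\<in>{0..T} in lebesgue. (exit_profile V L \<rho> has_real_derivative V * \<rho> t L) (at t)"
proof (rule integral_has_real_derivative_AE)
  show "(\<lambda>s. V * \<rho> s L) integrable_on {0..T}"
    by (rule set_lebesgue_integral_eq_integral[OF int])
  show "exit_profile V L \<rho> t = integral {0..t} (\<lambda>s. V * \<rho> s L)" if "t \<in> {0..T}" for t
    unfolding exit_profile_def
    by (intro set_lebesgue_integral_eq_integral set_integrable_subset[OF int]) (use that in auto)
qed

section \<open>Junction equations on the network\<close>

context supply_chain_network
begin

lemma outflow:
  assumes "e \<in> arcs G" "t \<in> {0..T}"
  shows "set_integrable lebesgue {0..t} (\<lambda>s. V e * \<rho> e s (L e))"
    and "exit_profile (V e) (L e) (\<rho> e) t =
      (if t < L e / V e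
       then (LINT \<zeta>:{L e - t * V e..L e}|lebesgue. \<rho>0 e \<zeta>)
       else (INF \<tau>\<in>{..t - L e / V e}. Q_hat (q0 e) (Q e) \<tau> - \<mu> e * \<tau>) + (t - L e / V e) * \<mu> e
            + (LINT \<zeta>:{0..L e}|lebesgue. \<rho>0 e \<zeta>))"
  using parameters_pos[OF assms(1)]
  by (intro transport_solution_outflow[OF _ _ _ q0_nonneg Q_mono Q_zero \<rho>0_L1 density]; use assms in simp)+

text \<open>\<open>junction\<close> presents \<open>Q e\<close> as the indefinite integral of the
  whole product, whose integrability it includes.\<close>

lemma Q_has_derivative_AE:
  assumes "v \<in> verts G" "e \<in> out_arcs G v"
  shows "AE t\<in>{0..T} in lebesgue.
    (Q e has_real_derivative A v e t * (\<Sum>d\<in>in_arcs G v. V d * \<rho> d t (L d))) (at t)"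
proof (rule integral_has_real_derivative_AE)
  let ?f = "\<lambda>t. A v e t * (\<Sum>d\<in>in_arcs G v. V d * \<rho> d t (L d))"
  have int: "(?f has_integral Q e t) {0..t}" if "t \<in> {0..T}" for t
    using has_integral_integral_lebesgue_on[of "{0..t}" ?f] junction[OF assms that]
    by (simp add: has_bochner_integral_iff)
  show "?f integrable_on {0..T}"
    using int[of T] T_pos by auto
  show "Q e t = integral {0..t} ?f" if "t \<in> {0..T}" for t
    using int[OF that] by (simp add: integral_unique)
qed

text \<open>Almost everywhere the derivative of each exit profile is the outflow appearing in the
  derivative of \<open>Q e\<close>. Differentiability is asserted as well because
  \<open>deriv\<close> is a choice operator and says nothing where no derivative exists.\<close>

lemma junction_derivative_AE:
  assumes "v \<in> verts G" "e \<in> out_arcs G v"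
  shows "AE t\<in>{0..T} in lebesgue.
    (\<forall>d\<in>in_arcs G v. exit_profile (V d) (L d) (\<rho> d) differentiable (at t)) \<and>
    (Q e has_real_derivative
      A v e t * (\<Sum>d\<in>in_arcs G v. deriv (exit_profile (V d) (L d) (\<rho> d)) t)) (at t)"
proof -
  \<comment> \<open>Each incoming arc has its own exceptional null set; finiteness allows their
    union.\<close>
  have "finite (in_arcs G v)"
    using finite_graph(2) by (rule finite_subset[rotated]) (auto simp: in_arcs_def)
  moreover have "AE t in lebesgue. t \<in> {0..T} \<longrightarrow>
      (exit_profile (V d) (L d) (\<rho> d) has_real_derivative V d * \<rho> d t (L d)) (at t)"
    if "d \<in> in_arcs G v" for d
    using that T_pos by (intro exit_profile_has_derivative_AE outflow) auto
  ultimately have "AE t in lebesgue. \<forall>d\<in>in_arcs G v. t \<in> {0..T} \<longrightarrow>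
      (exit_profile (V d) (L d) (\<rho> d) has_real_derivative V d * \<rho> d t (L d)) (at t)"
    by (intro AE_finite_allI)
  with Q_has_derivative_AE[OF assms] show ?thesis
  proof (eventually_elim, intro impI conjI ballI)
    fix t
    assume Q': "t \<in> {0..T} \<longrightarrow>
        (Q e has_real_derivative A v e t * (\<Sum>d\<in>in_arcs G v. V d * \<rho> d t (L d))) (at t)"
      and W': "\<forall>d\<in>in_arcs G v. t \<in> {0..T} \<longrightarrow>
        (exit_profile (V d) (L d) (\<rho> d) has_real_derivative V d * \<rho> d t (L d)) (at t)"
      and t: "t \<in> {0..T}"
    show "exit_profile (V d) (L d) (\<rho> d) differentiable (at t)" if "d \<in> in_arcs G v" for d
      using W' t that real_differentiable_def by blast
    have "deriv (exit_profile (V d) (L d) (\<rho> d)) t = V d * \<rho> d t (L d)" if "d \<in> in_arcs G v" for d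
      using W' t that by (auto intro: DERIV_imp_deriv)
    then show "(Q e has_real_derivative
        A v e t * (\<Sum>d\<in>in_arcs G v. deriv (exit_profile (V d) (L d) (\<rho> d)) t)) (at t)"
      using Q' t by simp
  qed
qed

end

theorem proposition3p7:
  fixes G :: "('v, 'e) pre_digraph"
    and T :: real
    and L V \<mu> q0 :: "'e \<Rightarrow> real"
    and \<rho>0 :: "'e \<Rightarrow> real \<Rightarrow> real"
    and A :: "'v \<Rightarrow> 'e \<Rightarrow> real \<Rightarrow> real"
    and Q Qh W :: "'e \<Rightarrow> real \<Rightarrow> real"
    and \<rho> :: "'e \<Rightarrow> real \<Rightarrow> real \<Rightarrow> real"
  assumes network: "supply_chain_network G T L V \<mu> q0 \<rho>0 A Q \<rho>"
  defines "Qh \<equiv> \<lambda>e. Q_hat (q0 e) (Q e)"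
    and "W \<equiv> \<lambda>e. exit_profile (V e) (L e) (\<rho> e)"
  shows "(\<forall>v\<in>verts G. \<forall>e\<in>out_arcs G v. AE t\<in>{0..T} in lebesgue.
            (\<forall>d\<in>in_arcs G v. W d differentiable (at t)) \<and>
            (Q e has_real_derivative A v e t * (\<Sum>d\<in>in_arcs G v. deriv (W d) t)) (at t))
       \<and> (\<forall>e\<in>arcs G. (\<forall>t\<le>0. Qh e t = 0) \<and> (\<forall>t\<in>{0<..T}. Qh e t = q0 e + Q e t))
       \<and> (\<forall>e\<in>arcs G. \<forall>t\<in>{0..T}.
            W e t =
              (if t < L e / V e
               then (LINT \<zeta>:{L e - t * V e..L e}|lebesgue. \<rho>0 e \<zeta>)
               else (INF \<tau>\<in>{..t - L e / V e}. Qh e \<tau> - \<mu> e * \<tau>)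
                    + (t - L e / V e) * \<mu> e
                    + (LINT \<zeta>:{0..L e}|lebesgue. \<rho>0 e \<zeta>)))"
proof -
  interpret supply_chain_network G T L V \<mu> q0 \<rho>0 A Q \<rho>
    by (rule network)
  show ?thesis
    unfolding Qh_def W_def using junction_derivative_AE outflow(2)
    by (auto simp: Q_hat_def)
qed

end
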